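(* Let $\{(W^k,H^k)\}_{k\ge 0}$ be a sequence generated by the column-wise update algorithm described in the context, which converges to $(W^*,H^* )$. If $s_2=r$, then $$F(W^*,H^* )\le F(W^*,H)\qquad\text{for all }H\in\mathcal G_3,$$ where $\mathcal G_3=\{H=(h_{tj})\in\mathbb R^{r\times n}: H\ge 0,\ \sum_{t=1}^r h_{tj}=1,\ j=1,\ldots,n\}$.
   Context: Setting. Let $V=[\mathbf v_1,\ldots,\mathbf v_n]\in\mathbb R^{m\times n}$ be a column stochastic matrix (entrywise nonnegative, each column summing to $1$), let $r<\min\{m,n\}$ be a positive integer, and let $s_1,s_2>0$ be prescribed integer sparsity levels. $\|\cdot\|$ is the Euclidean norm, $\|\cdot\|_F$ the Frobenius norm, $\|\cdot\|_2$ the spectral norm, $\|\mathbf x\|_0$ the number of nonzero entries. For a matrix $A$, $A(i,:)$ is its $i$-th row. Put $\mathcal P_n=\{\mathbf x\in\mathbb R^n: \mathbf x\ge 0,\ \sum_j x_j=1\}$ and $\mathcal Q_n^s=\{\mathbf x\in\mathbb R^n:\|\mathbf x\|_0\le s\}$; $\delta_{\mathcal K}$ is the indicator function ($0$ on $\mathcal K$, $+\infty$ off $\mathcal K$). For $W=[\mathbf w_1,\ldots,\mathbf w_r]\in\mathbb R^{m\times r}$ and $H=[\mathbf h_1,\ldots,\mathbf h_n]\in\mathbb R^{r\times n}$ let $$f(W,H)=f(\mathbf w_1,\ldots,\mathbf w_r,\mathbf h_1,\ldots,\mathbf h_n)=\tfrac12\|V-WH\|_F^2,$$ $$F(W,H)=f(W,H)+\sum_{i=1}^r\big(\delta_{\mathcal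 P_m}(\mathbf w_i)+\delta_{\mathcal Q_m^{s_1}}(\mathbf w_i)\big)+\sum_{t=1}^n\big(\delta_{\mathcal P_r}(\mathbf h_t)+\delta_{\mathcal Q_r^{s_2}}(\mathbf h_t)\big).$$ $\Pi_{\mathcal D}(\mathbf y)$ denotes the metric projection (a nearest point of $\mathcal D$ to $\mathbf y$); when the nearest point or an argmin is not unique, any choice is allowed. Algorithm. Choose $W^0$ with all columns in $\mathcal P_m\cap\mathcal Q_m^{s_1}$, $H^0$ with all columns in $\mathcal P_r\cap\mathcal Q_r^{s_2}$, $\delta_1>0$, $\delta_2>0$, $c\ge 1/\delta_2$. For $k=0,1,2,\ldots$: Step 1. For $i=1,\ldots,r$ in order: let $\phi_{i,k}(\mathbf w)=f(\mathbf w_1^{k+1},\ldots,\mathbf w_{i-1}^{k+1},\mathbf w,\mathbf w_{i+1}^k,\ldots,\mathbf w_r^k,H^k)$. If $\|H^k(i,:)\|=0$, set $\mathbf w_i^{k+1}=\mathbf w_i^k$. Otherwise compute $\bar{\mathbf w}_i^k=\operatorname{argmin}_{\mathbf w\in\mathcal P_m\cap\mathcal Q_m^{s_1}}\phi_{i,k}(\mathbf w)$; if $\phi_{i,k}(\mathbf w_i^k)-\phi_{i,k}(\bar{\mathbf w}_i^k)\ge\frac{\delta_1}{2}\|\mathbf w_i^k-\bar{\mathbf w}_i^k\|^2$, set $\mathbf w_i^{k+1}=\bar{\mathbf w}_i^k$; else set $\mathbf w_i^{k+1}=\Pi_{\mathcal P_m\cap\mathcal Q_m^{s_1}}(\mathbf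 w_i^k-\mu_{ik}\nabla\phi_{i,k}(\mathbf w_i^k))$ with $\mu_{ik}=1/(\|H^k(i,:)\|^2+\delta_1)$. Set $W^{k+1}=[\mathbf w_1^{k+1},\ldots,\mathbf w_r^{k+1}]$. Step 2. For $t=1,\ldots,n$: let $\psi_{t,k}(\mathbf h)=f(W^{k+1},\mathbf h_1^k,\ldots,\mathbf h_{t-1}^k,\mathbf h,\mathbf h_{t+1}^k,\ldots,\mathbf h_n^k)$, so $\nabla\psi_{t,k}(\mathbf h)=(W^{k+1})^T(W^{k+1}\mathbf h-\mathbf v_t)$. Take $\nu_{tk}=\min\{c,\ \|\nabla\psi_{t,k}(\mathbf h_t^k)\|^2/\|W^{k+1}\nabla\psi_{t,k}(\mathbf h_t^k)\|^2\}$ (equal to $c$ if the denominator is $0$) and compute $\bar{\mathbf h}_t^k=\Pi_{\mathcal P_r\cap\mathcal Q_r^{s_2}}(\mathbf h_t^k-\nu_{tk}\nabla\psi_{t,k}(\mathbf h_t^k))$. If $\psi_{t,k}(\mathbf h_t^k)-\psi_{t,k}(\bar{\mathbf h}_t^k)\ge\frac{\delta_2}{2}\|\mathbf h_t^k-\bar{\mathbf h}_t^k\|^2$, set $\mathbf h_t^{k+1}=\bar{\mathbf h}_t^k$; else redefine $\nu_{tk}=1/(\|(W^{k+1})^TW^{k+1}\|_2+\delta_2)$ and set $\mathbf h_t^{k+1}=\Pi_{\mathcal P_r\cap\mathcal Q_r^{s_2}}(\mathbf h_t^k-\nu_{tk}\nabla\psi_{t,k}(\mathbf h_t^k))$. Set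 $H^{k+1}=[\mathbf h_1^{k+1},\ldots,\mathbf h_n^{k+1}]$. *)

theory Defs
  imports "HOL-Analysis.Analysis"
begin

text \<open>
  A real m by n matrix has type \<open>real^'n^'m\<close>, with m and n the cardinalities of
  \<open>'m\<close> and \<open>'n\<close>. The norm of this type is the Frobenius norm; the spectral norm is
  \<^const>\<open>onorm\<close> of the associated linear map.
\<close>

definition column_stochastic :: "real^'n^'m \<Rightarrow> bool" where
  "column_stochastic A \<longleftrightarrow>
     (\<forall>i j. 0 \<le> A $ i $ j) \<and> (\<forall>j. (\<Sum>i\<in>UNIV. A $ i $ j) = 1)"

definition prob_simplex :: "(real^'d) set" where
  "prob_simplex = {x. (\<forall>j. 0 \<le> x $ j) \<and> (\<Sum>j\<in>UNIV. x $ j) = 1}"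

definition l0_norm :: "real^'d \<Rightarrow> nat" where
  "l0_norm x = card {j. x $ j \<noteq> 0}"

definition sparse_vecs :: "nat \<Rightarrow> (real^'d) set" where
  "sparse_vecs s = {x. l0_norm x \<le> s}"

definition ind_fun :: "'a set \<Rightarrow> 'a \<Rightarrow> ereal" where
  "ind_fun K x = (if x \<in> K then 0 else \<infinity>)"

definition obj_f :: "real^'n^'m \<Rightarrow> real^'r^'m \<Rightarrow> real^'n^'r \<Rightarrow> real" where
  "obj_f V W H = (1/2) * (norm (V - W ** H))\<^sup>2"

definition obj_F ::
  "real^'n^'m \<Rightarrow> nat \<Rightarrow> nat \<Rightarrow> real^'r^'m \<Rightarrow> real^'n^'r \<Rightarrow> ereal" where
  "obj_F V s1 s2 W H =
     ereal (obj_f V W H)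
     + (\<Sum>i\<in>UNIV. ind_fun prob_simplex (column i W) + ind_fun (sparse_vecs s1) (column i W))
     + (\<Sum>t\<in>UNIV. ind_fun prob_simplex (column t H) + ind_fun (sparse_vecs s2) (column t H))"

definition gradient :: "('a::real_inner \<Rightarrow> real) \<Rightarrow> 'a \<Rightarrow> 'a" where
  "gradient g x = (THE d. GDERIV g x :> d)"

text \<open>
  Nearest points and minimizers need not be unique, so both are relations
  (\<^const>\<open>is_arg_min\<close>) rather than chosen values.
\<close>

definition is_proj :: "'a::metric_space set \<Rightarrow> 'a \<Rightarrow> 'a \<Rightarrow> bool" where
  "is_proj D y p \<longleftrightarrow> is_arg_min (\<lambda>x. dist y x) (\<lambda>x. x \<in> D) p"

definition replace_column :: "real^'c^'d \<Rightarrow> 'c \<Rightarrow> real^'d \<Rightarrow> real^'c^'d" where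
  "replace_column A t h = (\<chi> a j. if j = t then h $ a else A $ a $ j)"

text \<open>
  The columns of W are processed along the linear order of the index type \<open>'r\<close>:
  those before i come from the new iterate \<open>W'\<close>, those after i from the old iterate W.
\<close>

definition phi ::
  "real^'n^'m \<Rightarrow> real^'n^'r::{finite,linorder} \<Rightarrow> real^'r::{finite,linorder}^'m \<Rightarrow> real^'r::{finite,linorder}^'m \<Rightarrow> 'r::{finite,linorder} \<Rightarrow> real^'m \<Rightarrow> real"
where
  "phi V H W W' i w =
     obj_f V (\<chi> a j. if j < i then W' $ a $ j else if j = i then w $ a else W $ a $ j) H"

definition psi ::
  "real^'n^'m \<Rightarrow> real^'r^'m \<Rightarrow> real^'n^'r \<Rightarrow> 'n \<Rightarrow> real^'r \<Rightarrow> real" where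
  "psi V W H t h = obj_f V W (replace_column H t h)"

text \<open>
  \<open>W_update V s1 d1 H W W' i\<close> relates column i of the new iterate \<open>W'\<close> to the old
  data \<open>(W, H)\<close> and the columns of \<open>W'\<close> before i; imposed for every i, it describes
  one full sweep.
\<close>

definition W_update ::
  "real^'n^'m \<Rightarrow> nat \<Rightarrow> real \<Rightarrow> real^'n^'r::{finite,linorder} \<Rightarrow> real^'r::{finite,linorder}^'m \<Rightarrow> real^'r::{finite,linorder}^'m \<Rightarrow> 'r::{finite,linorder} \<Rightarrow> bool"
where
  "W_update V s1 d1 H W W' i \<longleftrightarrow>
     (let D = prob_simplex \<inter> sparse_vecs s1;
          \<phi> = phi V H W W' i;
          w = column i W;
          \<mu> = 1 / ((norm (row i H))\<^sup>2 + d1)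
      in if norm (row i H) = 0 then column i W' = w
         else \<exists>wb. is_arg_min \<phi> (\<lambda>x. x \<in> D) wb \<and>
                (if \<phi> w - \<phi> wb \<ge> d1 / 2 * (norm (w - wb))\<^sup>2
                 then column i W' = wb
                 else is_proj D (w - \<mu> *\<^sub>R gradient \<phi> w) (column i W')))"

definition H_update ::
  "real^'n^'m \<Rightarrow> nat \<Rightarrow> real \<Rightarrow> real \<Rightarrow> real^'r^'m \<Rightarrow> real^'n^'r \<Rightarrow> real^'n^'r \<Rightarrow> 'n \<Rightarrow> bool"
where
  "H_update V s2 d2 c W' H H' t \<longleftrightarrow>
     (let D = prob_simplex \<inter> sparse_vecs s2;
          \<psi> = psi V W' H t;
          h = column t H;
          g = gradient \<psi> h;
          \<nu> = (if (norm (W' *v g))\<^sup>2 = 0 then c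
               else min c ((norm g)\<^sup>2 / (norm (W' *v g))\<^sup>2));
          \<nu>' = 1 / (onorm ((*v) (transpose W' ** W')) + d2)
      in \<exists>hb. is_proj D (h - \<nu> *\<^sub>R g) hb \<and>
           (if \<psi> h - \<psi> hb \<ge> d2 / 2 * (norm (h - hb))\<^sup>2
            then column t H' = hb
            else is_proj D (h - \<nu>' *\<^sub>R g) (column t H')))"

definition generated_by_algorithm ::
  "real^'n^'m \<Rightarrow> nat \<Rightarrow> nat \<Rightarrow> real \<Rightarrow> real \<Rightarrow> real \<Rightarrow>
   (nat \<Rightarrow> real^'r::{finite,linorder}^'m) \<Rightarrow> (nat \<Rightarrow> real^'n^'r::{finite,linorder}) \<Rightarrow> bool"
where
  "generated_by_algorithm V s1 s2 d1 d2 c W H \<longleftrightarrow>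
     (\<forall>i. column i (W 0) \<in> prob_simplex \<inter> sparse_vecs s1) \<and>
     (\<forall>t. column t (H 0) \<in> prob_simplex \<inter> sparse_vecs s2) \<and>
     (\<forall>k. (\<forall>i. W_update V s1 d1 (H k) (W k) (W (Suc k)) i) \<and>
          (\<forall>t. H_update V s2 d2 c (W (Suc k)) (H k) (H (Suc k)) t))"

definition G3 :: "(real^'n^'r) set" where
  "G3 = {H. (\<forall>t j. 0 \<le> H $ t $ j) \<and> (\<forall>j. (\<Sum>t\<in>UNIV. H $ t $ j) = 1)}"

end

theory Submission
  imports Defs
begin

text \<open>
  For \<open>s2 = r\<close> the sparsity constraint on H is void, so every update of a column of H is a
  projected gradient step onto the convex set \<^const>\<open>prob_simplex\<close>, whichever branch is
  taken. The step sizes are bounded away from 0 because the spectral norms of the convergent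
  sequence W are bounded. Dividing the variational inequality of the projection by the step
  size and letting the iteration index tend to infinity gives the first-order optimality
  condition at \<open>Hstar\<close>, which suffices because the objective is a sum of convex least-squares
  terms, one for each column of H. The indicator terms of \<open>Wstar\<close> occur on both sides, so the
  updates of W play no role.
\<close>

section \<open>Frobenius norm estimates and adjoints\<close>

lemma norm_sq_columns:
  fixes A :: "real^'n^'m"
  shows "(norm A)\<^sup>2 = (\<Sum>j\<in>UNIV. (norm (column j A))\<^sup>2)"
proof -
  have "(norm A)\<^sup>2 = (\<Sum>i\<in>UNIV. \<Sum>j\<in>UNIV. A $ i $ j * A $ i $ j)"
    by (simp add: power2_norm_eq_inner inner_vec_def)
  also have "\<dots> = (\<Sum>j\<in>UNIV. \<Sum>i\<in>UNIV. A $ i $ j * A $ i $ j)"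
    by (rule sum.swap)
  also have "\<dots> = (\<Sum>j\<in>UNIV. (norm (column j A))\<^sup>2)"
    by (simp add: power2_norm_eq_inner inner_vec_def column_def)
  finally show ?thesis .
qed

text \<open>Cauchy-Schwarz in each row. The Frobenius norm serves as an upper bound for the spectral
  norm whose limit along \<open>W\<close> is immediate.\<close>

lemma norm_matrix_vector_mult_le_norm:
  fixes A :: "real^'n^'m"
  shows "norm (A *v x) \<le> norm A * norm x"
proof -
  have "(norm (A *v x))\<^sup>2 = (\<Sum>i\<in>UNIV. (A $ i \<bullet> x)\<^sup>2)"
    unfolding power2_norm_eq_inner inner_vec_def[of "A *v x"] matrix_vector_mul_component
    by (simp add: power2_eq_square)
  also have "\<dots> \<le> (\<Sum>i\<in>UNIV. (A $ i \<bullet> A $ i) * (x \<bullet> x))"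
    by (intro sum_mono Cauchy_Schwarz_ineq)
  also have "\<dots> = (norm A * norm x)\<^sup>2"
    by (simp add: power_mult_distrib power2_norm_eq_inner inner_vec_def[of A] sum_distrib_right)
  finally show ?thesis
    by (rule power2_le_imp_le) simp
qed

lemma inner_transpose_mult_vec:
  fixes A :: "real^'n^'m"
  shows "(transpose A *v y) \<bullet> x = y \<bullet> (A *v x)"
  by (metis dot_lmul_matrix vector_transpose_matrix transpose_transpose)

lemma norm_transpose_mult_vec_le:
  fixes A :: "real^'n^'m"
  shows "norm (transpose A *v y) \<le> norm A * norm y"
proof -
  have "norm (transpose A) = norm A"
    unfolding norm_eq_sqrt_inner inner_vec_def transpose_def
    by (simp, rule sum.swap)
  then show ?thesis
    using norm_matrix_vector_mult_le_norm[of "transpose A" y] by simp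
qed

text \<open>Controls the reciprocal of the fallback step size, the only place where the spectral
  norm enters the algorithm.\<close>

lemma onorm_gram_le:
  fixes A :: "real^'n^'m"
  shows "onorm ((*v) (transpose A ** A)) \<le> (norm A)\<^sup>2"
proof (rule onorm_bound)
  fix x
  have "norm ((transpose A ** A) *v x) = norm (transpose A *v (A *v x))"
    by (simp add: matrix_vector_mul_assoc)
  also have "\<dots> \<le> norm A * norm (A *v x)"
    by (rule norm_transpose_mult_vec_le)
  also have "\<dots> \<le> norm A * (norm A * norm x)"
    by (intro mult_left_mono norm_matrix_vector_mult_le_norm) simp
  finally show "norm ((transpose A ** A) *v x) \<le> (norm A)\<^sup>2 * norm x"
    by (simp add: power2_eq_square mult.assoc)
qed simp

section \<open>Limits of matrix expressions\<close>

lemma tendsto_matrix_vector_mult: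
  fixes A :: "'a \<Rightarrow> real^'n^'m"
  assumes "(A \<longlongrightarrow> A0) F" "(x \<longlongrightarrow> x0) F"
  shows "((\<lambda>k. A k *v x k) \<longlongrightarrow> A0 *v x0) F"
proof (rule vec_tendstoI)
  fix i
  show "((\<lambda>k. (A k *v x k) $ i) \<longlongrightarrow> (A0 *v x0) $ i) F"
    unfolding matrix_vector_mul_component
    by (intro tendsto_inner tendsto_vec_nth assms)
qed

lemma tendsto_transpose:
  fixes A :: "'a \<Rightarrow> real^'n^'m"
  assumes "(A \<longlongrightarrow> A0) F"
  shows "((\<lambda>k. transpose (A k)) \<longlongrightarrow> transpose A0) F"
  unfolding transpose_def by (intro tendsto_vec_lambda tendsto_vec_nth assms)

lemma tendsto_column:
  fixes A :: "'a \<Rightarrow> real^'n^'m"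
  assumes "(A \<longlongrightarrow> A0) F"
  shows "((\<lambda>k. column j (A k)) \<longlongrightarrow> column j A0) F"
  unfolding column_def by (intro tendsto_vec_lambda tendsto_vec_nth assms)

section \<open>Column-wise splitting of the objective and its gradient\<close>

lemma gradient_eqI:
  assumes "GDERIV g x :> d"
  shows "gradient g x = d"
  unfolding gradient_def
proof (rule the_equality)
  show "GDERIV g x :> d" by (rule assms)
next
  \<comment> \<open>\<open>gradient\<close> is a definite description, so its value is known only
    once the derivative is seen to be unique.\<close>
  fix e assume "GDERIV g x :> e"
  then have "(\<lambda>h. h \<bullet> e) = (\<lambda>h. h \<bullet> d)"
    using assms unfolding gderiv_def by (rule has_derivative_unique)
  then show "e = d"
    by (metis vector_eq_ldot)
qed

lemma obj_f_columns:
  "obj_f V W H = 1/2 * (\<Sum>j\<in>UNIV. (norm (column j V - W *v column j H))\<^sup>2)"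
proof -
  have "column j (V - W ** H) = column j V - W *v column j H" for j
    by (simp add: vec_eq_iff column_def matrix_matrix_mult_def matrix_vector_mult_def)
  then show ?thesis
    by (simp add: obj_f_def norm_sq_columns)
qed

text \<open>Isolates the dependence on \<open>h\<close>: the second sum is constant and disappears
  on differentiation.\<close>

lemma psi_eq:
  "psi V W H t h =
     1/2 * (norm (column t V - W *v h))\<^sup>2
       + 1/2 * (\<Sum>j\<in>UNIV - {t}. (norm (column j V - W *v column j H))\<^sup>2)"
proof -
  have "column j (replace_column H t h) = (if j = t then h else column j H)" for j
    by (simp add: vec_eq_iff column_def replace_column_def)
  then show ?thesis
    by (simp add: psi_def obj_f_columns sum.remove[of UNIV t] ring_distribs)
qed

lemma gradient_psi:
  "gradient (psi V W H t) h = transpose W *v (W *v h - column t V)"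
proof (rule gradient_eqI)
  have W: "((\<lambda>x. W *v x) has_derivative (\<lambda>d. W *v d)) (at h)"
    by (rule bounded_linear_imp_has_derivative) simp
  have "((\<lambda>x. psi V W H t x) has_derivative
      (\<lambda>d. d \<bullet> (transpose W *v (W *v h - column t V)))) (at h)"
    unfolding psi_eq power2_norm_eq_inner
    by (rule derivative_eq_intros W refl)+
      (simp add: fun_eq_iff inner_commute[of _ "_ v* _"] dot_lmul_matrix inner_diff_left
        inner_diff_right inner_commute[of _ "W *v h"] inner_commute[of _ "column t V"])
  then show "GDERIV (psi V W H t) h :> transpose W *v (W *v h - column t V)"
    by (simp add: gderiv_def)
qed

section \<open>First-order conditions: least squares and projections\<close>

lemma least_squares_variational_optimal:
  fixes A :: "real^'n^'m"
  assumes "0 \<le> (transpose A *v (A *v x - v)) \<bullet> (z - x)"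
  shows "(norm (v - A *v x))\<^sup>2 \<le> (norm (v - A *v z))\<^sup>2"
proof -
  \<comment> \<open>With this choice the residual at \<open>z\<close> is \<open>a - b\<close>.
    Expanding its square leaves a cross term, whose sign is the hypothesis moved across the adjoint,
    and a nonnegative square.\<close>
  define a b where "a = v - A *v x" and "b = A *v (z - x)"
  have "0 \<le> - (a \<bullet> b)"
    using assms unfolding inner_transpose_mult_vec by (simp add: a_def b_def inner_diff_left)
  moreover have "(norm (a - b))\<^sup>2 = (norm a)\<^sup>2 - 2 * (a \<bullet> b) + (norm b)\<^sup>2"
    by (simp add: power2_norm_eq_inner inner_diff_left inner_diff_right inner_commute)
  ultimately have "(norm a)\<^sup>2 \<le> (norm (a - b))\<^sup>2"
    using zero_le_power2[of "norm b"] by linarith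
  then show ?thesis
    by (simp add: a_def b_def matrix_vector_mult_diff_distrib)
qed

text \<open>A first-order condition with an error term: if \<open>B\<close> stays bounded and the
  step length \<open>norm (h - p)\<close> tends to 0, the left side vanishes in the limit, whether
  or not the step sizes converge.\<close>

lemma is_proj_step_lower_bound:
  fixes h g p z :: "'a::euclidean_space"
  assumes "convex D" "closed D" "is_proj D (h - \<nu> *\<^sub>R g) p" "z \<in> D"
    and "0 < \<nu>" "1 / \<nu> \<le> B"
  shows "- (B * (norm (h - p) * norm (z - p))) \<le> g \<bullet> (z - p)"
proof -
  have p: "p \<in> D" "\<forall>y\<in>D. dist (h - \<nu> *\<^sub>R g) p \<le> dist (h - \<nu> *\<^sub>R g) y"
    using assms(3) by (auto simp: is_proj_def is_arg_min_linorder)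
  \<comment> \<open>Obtuse angle criterion for the nearest point of a closed convex set.\<close>
  have "(h - \<nu> *\<^sub>R g - p) \<bullet> (z - p) \<le> 0"
    by (rule any_closest_point_dot[OF assms(1,2) p(1) assms(4) p(2)])
  then have "(h - p) \<bullet> (z - p) \<le> \<nu> * (g \<bullet> (z - p))"
    by (simp add: inner_diff_left)
  then have "1 / \<nu> * ((h - p) \<bullet> (z - p)) \<le> g \<bullet> (z - p)"
    using \<open>0 < \<nu>\<close> by (simp add: field_simps)
  moreover have "- (norm (h - p) * norm (z - p)) \<le> (h - p) \<bullet> (z - p)"
    using Cauchy_Schwarz_ineq2[of "h - p" "z - p"] by linarith
  then have "1 / \<nu> * - (norm (h - p) * norm (z - p)) \<le> 1 / \<nu> * ((h - p) \<bullet> (z - p))"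
    using \<open>0 < \<nu>\<close> by (intro mult_left_mono) auto
  moreover have "1 / \<nu> * (norm (h - p) * norm (z - p)) \<le> B * (norm (h - p) * norm (z - p))"
    using assms(6) by (intro mult_right_mono) auto
  ultimately show ?thesis by simp
qed

section \<open>The feasible set of a column of \<open>H\<close> and its update\<close>

lemma convex_prob_simplex: "convex prob_simplex"
proof (rule convexI)
  fix x y :: "real^'d" and u v :: real
  assume xy: "x \<in> prob_simplex" "y \<in> prob_simplex" and uv: "0 \<le> u" "0 \<le> v" "u + v = 1"
  have "(\<Sum>j\<in>UNIV. (u *\<^sub>R x + v *\<^sub>R y) $ j) = u * (\<Sum>j\<in>UNIV. x $ j) + v * (\<Sum>j\<in>UNIV. y $ j)"
    by (simp add: sum.distrib sum_distrib_left)
  then show "u *\<^sub>R x + v *\<^sub>R y \<in> prob_simplex"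
    using xy uv by (simp add: prob_simplex_def)
qed

lemma closed_prob_simplex: "closed prob_simplex"
  unfolding prob_simplex_def
  by (intro closed_Collect_conj closed_Collect_all closed_Collect_le closed_Collect_eq
      continuous_intros)

lemma sparse_vecs_card: "sparse_vecs CARD('d) = (UNIV :: (real^'d) set)"
  by (auto simp: sparse_vecs_def l0_norm_def intro: card_mono)

text \<open>Both branches are projected gradient steps, so the acceptance test can be forgotten. The
  bound on \<open>1 / \<nu>\<close> adds up what the possible step sizes require:
  \<open>1 / c\<close> for \<open>c\<close>, the squared norm of \<open>W'\<close> for the quotient,
  and that plus \<open>d2\<close> for the fallback.\<close>

lemma H_update_step:
  fixes W' :: "real^'r^'m" and H H' :: "real^'n^'r"
  assumes upd: "H_update V s2 d2 c W' H H' t" and "s2 = CARD('r)" "0 < c" "0 < d2"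
  obtains \<nu> where "0 < \<nu>" "1 / \<nu> \<le> 1 / c + (norm W')\<^sup>2 + d2"
    "is_proj prob_simplex
       (column t H - \<nu> *\<^sub>R (transpose W' *v (W' *v column t H - column t V))) (column t H')"
proof -
  define g where "g = transpose W' *v (W' *v column t H - column t V)"
  define L where "L = onorm ((*v) (transpose W' ** W'))"
  define \<nu> where "\<nu> = (if (norm (W' *v g))\<^sup>2 = 0 then c
    else min c ((norm g)\<^sup>2 / (norm (W' *v g))\<^sup>2))"
  define \<nu>' where "\<nu>' = 1 / (L + d2)"
  have cases: "is_proj prob_simplex (column t H - \<nu> *\<^sub>R g) (column t H') \<or>
      is_proj prob_simplex (column t H - \<nu>' *\<^sub>R g) (column t H')"
    using upd
    unfolding H_update_def Let_def gradient_psi assms(2) sparse_vecs_card Int_UNIV_right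
    unfolding g_def[symmetric] L_def[symmetric]
    unfolding \<nu>_def[symmetric] \<nu>'_def[symmetric]
    by (auto split: if_splits)
  have "0 \<le> L"
    unfolding L_def by (intro onorm_pos_le) simp
  then have \<nu>': "0 < \<nu>'" "1 / \<nu>' \<le> 1 / c + (norm W')\<^sup>2 + d2"
    using onorm_gram_le[of W'] assms(3,4) by (auto simp: \<nu>'_def L_def add_nonneg_pos add_increasing)
  have \<nu>: "0 < \<nu> \<and> 1 / \<nu> \<le> 1 / c + (norm W')\<^sup>2 + d2"
  proof (cases "W' *v g = 0 \<or> c \<le> (norm g)\<^sup>2 / (norm (W' *v g))\<^sup>2")
    case True
    then have "\<nu> = c" by (auto simp: \<nu>_def)
    then show ?thesis using assms(3,4) by (simp add: add_increasing2)
  next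
    case False
    \<comment> \<open>Here \<open>W' *v g\<close> is nonzero, hence so is \<open>g\<close>, and the
      quotient is positive.\<close>
    then have "g \<noteq> 0" by auto
    have "\<nu> = (norm g)\<^sup>2 / (norm (W' *v g))\<^sup>2"
      using False by (auto simp: \<nu>_def)
    moreover have "(norm (W' *v g))\<^sup>2 \<le> (norm W')\<^sup>2 * (norm g)\<^sup>2"
      using power_mono[OF norm_matrix_vector_mult_le_norm[of W' g], of 2]
      by (simp add: power_mult_distrib)
    ultimately have "0 < \<nu>" "1 / \<nu> \<le> (norm W')\<^sup>2"
      using False \<open>g \<noteq> 0\<close> by (simp_all add: pos_divide_le_eq)
    moreover have "0 < 1 / c"
      using \<open>0 < c\<close> by simp
    ultimately show ?thesis using \<open>0 < d2\<close> by linarith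
  qed
  show thesis
    using cases
  proof
    assume "is_proj prob_simplex (column t H - \<nu> *\<^sub>R g) (column t H')"
    then show thesis using \<nu> by (intro that[of \<nu>]) (simp_all add: g_def)
  next
    assume "is_proj prob_simplex (column t H - \<nu>' *\<^sub>R g) (column t H')"
    then show thesis using \<nu>' by (intro that[of \<nu>']) (simp_all add: g_def)
  qed
qed

theorem theorem3p13:
  fixes V :: "real^'n^'m"
    and W :: "nat \<Rightarrow> real^'r::{finite,linorder}^'m"
    and H :: "nat \<Rightarrow> real^'n^'r::{finite,linorder}"
    and Wstar :: "real^'r::{finite,linorder}^'m" and Hstar :: "real^'n^'r::{finite,linorder}"
    and s1 s2 :: nat and d1 d2 c :: real
  assumes "column_stochastic V"
    and "CARD('r) < min CARD('m) CARD('n)"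
    and "s1 > 0" and "s2 > 0"
    and "d1 > 0" and "d2 > 0" and "c \<ge> 1 / d2"
    and "generated_by_algorithm V s1 s2 d1 d2 c W H"
    and "(\<lambda>k. (W k, H k)) \<longlonglongrightarrow> (Wstar, Hstar)"
    and "s2 = CARD('r)"
  shows "\<forall>H'\<in>G3. obj_F V s1 s2 Wstar Hstar \<le> obj_F V s1 s2 Wstar H'"
proof
  fix H' :: "real^'n^'r::{finite,linorder}"
  assume "H' \<in> G3"
  then have H': "column t H' \<in> prob_simplex" for t
    by (simp add: G3_def prob_simplex_def column_def)
  have "0 < c"
    using assms(6,7) by (meson less_le_trans zero_less_divide_1_iff)
  have lim: "W \<longlonglongrightarrow> Wstar" "H \<longlonglongrightarrow> Hstar"
    using tendsto_fst[OF assms(9)] tendsto_snd[OF assms(9)] by simp_all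
  \<comment> \<open>The update of \<open>H k\<close> already uses \<open>W (Suc k)\<close>, hence
    the shifted limits.\<close>
  note lim' = lim[THEN LIMSEQ_Suc]
  define B where "B k = 1 / c + (norm (W (Suc k)))\<^sup>2 + d2" for k
  have limB: "B \<longlonglongrightarrow> 1 / c + (norm Wstar)\<^sup>2 + d2"
    unfolding B_def by (intro tendsto_intros lim')
  have mem: "column t Hstar \<in> prob_simplex"
    and var: "0 \<le> (transpose Wstar *v (Wstar *v column t Hstar - column t V))
      \<bullet> (column t H' - column t Hstar)" for t
  proof -
    define h g where "h k = column t (H k)"
      and "g k = transpose (W (Suc k)) *v (W (Suc k) *v h k - column t V)" for k
    define z where "z = column t H'"
    have step: "\<exists>\<nu>>0. 1 / \<nu> \<le> B k \<and> is_proj prob_simplex (h k - \<nu> *\<^sub>R g k) (h (Suc k))" for k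
    proof -
      have "H_update V s2 d2 c (W (Suc k)) (H k) (H (Suc k)) t"
        using assms(8) by (simp add: generated_by_algorithm_def)
      from H_update_step[OF this assms(10) \<open>0 < c\<close> assms(6)] show ?thesis
        unfolding B_def h_def g_def by metis
    qed
    have limh: "h \<longlonglongrightarrow> column t Hstar"
      unfolding h_def by (intro tendsto_column lim)
    note limh' = limh[THEN LIMSEQ_Suc]
    have limg: "g \<longlonglongrightarrow> transpose Wstar *v (Wstar *v column t Hstar - column t V)"
      unfolding g_def
      by (intro tendsto_matrix_vector_mult tendsto_transpose tendsto_diff tendsto_const lim' limh)
    have "h (Suc k) \<in> prob_simplex" for k
      using step[of k] by (auto simp: is_proj_def is_arg_min_def)
    then show "column t Hstar \<in> prob_simplex"
      using closed_sequentially[OF closed_prob_simplex _ limh'] by blast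
    have "- (B k * (norm (h k - h (Suc k)) * norm (z - h (Suc k)))) \<le> g k \<bullet> (z - h (Suc k))" for k
      using step[of k] is_proj_step_lower_bound[OF convex_prob_simplex closed_prob_simplex]
        H'[of t] unfolding z_def by blast
    \<comment> \<open>Consecutive iterates share their limit, so this limit is 0; it is left
      unsimplified to match the limit rules.\<close>
    moreover have "(\<lambda>k. - (B k * (norm (h k - h (Suc k)) * norm (z - h (Suc k))))) \<longlonglongrightarrow>
        - ((1 / c + (norm Wstar)\<^sup>2 + d2) *
            (norm (column t Hstar - column t Hstar) * norm (z - column t Hstar)))"
      by (intro tendsto_intros limB limh limh')
    moreover have "(\<lambda>k. g k \<bullet> (z - h (Suc k))) \<longlonglongrightarrow>
        (transpose Wstar *v (Wstar *v column t Hstar - column t V)) \<bullet> (z - column t Hstar)"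
      by (intro tendsto_intros limg limh')
    ultimately show "0 \<le> (transpose Wstar *v (Wstar *v column t Hstar - column t V))
        \<bullet> (column t H' - column t Hstar)"
      unfolding z_def by (auto dest: LIMSEQ_le)
  qed
  have "obj_f V Wstar Hstar \<le> obj_f V Wstar H'"
    unfolding obj_f_columns
    by (intro mult_left_mono sum_mono least_squares_variational_optimal var) simp
  \<comment> \<open>Applied to both \<open>Hstar\<close> and \<open>H'\<close>. What remains is
    monotonicity of addition in \<open>ereal\<close>, which also covers an infinite indicator sum
    for \<open>Wstar\<close>.\<close>
  moreover have "(\<Sum>t\<in>UNIV. ind_fun prob_simplex (column t A) + ind_fun (sparse_vecs s2) (column t A)) = 0"
    if "\<And>t. column t A \<in> prob_simplex" for A :: "real^'n^'r::{finite,linorder}"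
    using that by (simp add: ind_fun_def assms(10) sparse_vecs_card)
  ultimately show "obj_F V s1 s2 Wstar Hstar \<le> obj_F V s1 s2 Wstar H'"
    unfolding obj_F_def using mem H' by (simp add: add_right_mono)
qed

end
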